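(* Let $\mathcal{H}=(V,\mathcal{E})$ be a hypergraph in $\mathcal{L}_0'$, i.e. every edge has even size, every cycle $(e_1,\ldots,e_r)$ of $\mathcal{H}$ has distinct vertices $u,v\in\bigcup_{1\le i\le r}e_i$ with $\{u,v\}\in\mathcal{E}$, and the spanning subhypergraph $(V,\mathcal{E}_2)$ with $\mathcal{E}_2=\{e\in\mathcal{E}:|e|=2\}$ is connected. Let $Q(\mathcal{H},\lambda)=P(\mathcal{H},\lambda)/\lambda$. Then $(-1)^{|V|+1}Q(\mathcal{H},\lambda)>0$ for all real $\lambda\in[0,1)$.
   Context: A hypergraph $\mathcal{H}=(V,\mathcal{E})$ consists of a finite vertex set $V$ and a set $\mathcal{E}$ of non-empty subsets of $V$ (edges). For a positive integer $k$, a weak proper $k$-coloring is a map $\phi:V\to\{1,\ldots,k\}$ with $|\{\phi(v):v\in e\}|\ge2$ for each $e\in\mathcal{E}$; the chromatic polynomial $P(\mathcal{H},\lambda)$ is the polynomial whose value at each positive integer $k$ is the number of such colorings. When $V\ne\emptyset$, $P(\mathcal{H},0)=0$, so $Q(\mathcal{H},\lambda)=P(\mathcal{H},\lambda)/\lambda$ is a polynomial. A cycle in $\mathcal{H}$ is a sequence $(v_1,e_1,\ldots,v_t,e_t,v_1)$ with $t\ge2$, pairwise distinct vertices $v_i$, pairwise distinct edges $e_i$, and $\{v_i,v_{i+1}\}\subseteq e_i$ ($v_{t+1}=v_1$); it is also written $(e_1,\ldots,e_t)$. The graph $(V,\mathcal{E}_2)$ being connected means $V\ne\emptyset$ and any two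 vertices are joined by a path using edges of size $2$. *)

theory Defs
  imports
    "HOL-Library.FuncSet"
    "HOL-Computational_Algebra.Polynomial"
begin

definition hypergraph :: "'a set \<Rightarrow> 'a set set \<Rightarrow> bool" where
  "hypergraph V E \<longleftrightarrow> finite V \<and> (\<forall>e\<in>E. e \<noteq> {} \<and> e \<subseteq> V)"

(* Colorings are extensional functions, so that a map with domain V is counted exactly once. *)
definition weak_proper_colorings :: "'a set \<Rightarrow> 'a set set \<Rightarrow> nat \<Rightarrow> ('a \<Rightarrow> nat) set" where
  "weak_proper_colorings V E k = {\<phi> \<in> V \<rightarrow>\<^sub>E {1..k}. \<forall>e\<in>E. card (\<phi> ` e) \<ge> 2}"

(* Existence and uniqueness of the described polynomial, and P(0) = 0 for nonempty V (so that
   the division in chromatic_quotient is exact), are proved at the end of this theory. *)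
definition chromatic_poly :: "'a set \<Rightarrow> 'a set set \<Rightarrow> real poly" where
  "chromatic_poly V E =
     (THE p. \<forall>k::nat. k > 0 \<longrightarrow> poly p (real k) = real (card (weak_proper_colorings V E k)))"

definition chromatic_quotient :: "'a set \<Rightarrow> 'a set set \<Rightarrow> real poly" where
  "chromatic_quotient V E = chromatic_poly V E div [:0, 1:]"

(* The cycle (v_1, e_1, ..., v_t, e_t, v_1), with the lists vs and es indexed from 0. *)
definition hypercycle :: "'a set \<Rightarrow> 'a set set \<Rightarrow> 'a list \<Rightarrow> 'a set list \<Rightarrow> bool" where
  "hypercycle V E vs es \<longleftrightarrow>
     length vs = length es \<and> length es \<ge> 2 \<and>
     set vs \<subseteq> V \<and> set es \<subseteq> E \<and> distinct vs \<and> distinct es \<and>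
     (\<forall>i < length es. {vs ! i, vs ! (Suc i mod length es)} \<subseteq> es ! i)"

definition edges2 :: "'a set set \<Rightarrow> 'a set set" where
  "edges2 E = {e \<in> E. card e = 2}"

definition connected2 :: "'a set \<Rightarrow> 'a set set \<Rightarrow> bool" where
  "connected2 V E \<longleftrightarrow>
     V \<noteq> {} \<and> (\<forall>u\<in>V. \<forall>v\<in>V. (u, v) \<in> {(x, y). {x, y} \<in> edges2 E}\<^sup>*)"

definition class_L0' :: "'a set \<Rightarrow> 'a set set \<Rightarrow> bool" where
  "class_L0' V E \<longleftrightarrow>
     (\<forall>e\<in>E. even (card e)) \<and>
     (\<forall>vs es. hypercycle V E vs es \<longrightarrow>
        (\<exists>u\<in>\<Union>(set es). \<exists>v\<in>\<Union>(set es). u \<noteq> v \<and> {u, v} \<in> E)) \<and>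
     connected2 V E"


definition exact_colorings :: "'a set \<Rightarrow> 'a set set \<Rightarrow> nat set \<Rightarrow> ('a \<Rightarrow> nat) set" where
  "exact_colorings V E S = {\<phi> \<in> V \<rightarrow>\<^sub>E S. \<phi> ` V = S \<and> (\<forall>e\<in>E. card (\<phi> ` e) \<ge> 2)}"

lemma card_exact_colorings_le:
  assumes H: "hypergraph V E" and fin: "finite S" "finite T" and ST: "card S = card T"
  shows "card (exact_colorings V E S) \<le> card (exact_colorings V E T)"
proof -
  obtain h where h: "bij_betw h S T"
    using fin ST finite_same_card_bij by blast
  define g where "g = (\<lambda>\<phi>. restrict (h \<circ> \<phi>) V)"
  have finT: "finite (exact_colorings V E T)"
    using H fin unfolding exact_colorings_def hypergraph_def
    by (simp add: finite_PiE)
  have inj: "inj_on g (exact_colorings V E S)"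
  proof (rule inj_onI)
    fix a b assume a: "a \<in> exact_colorings V E S" and b: "b \<in> exact_colorings V E S" and ab: "g a = g b"
    show "a = b"
    proof (rule PiE_ext)
      show "a \<in> V \<rightarrow>\<^sub>E S" "b \<in> V \<rightarrow>\<^sub>E S" using a b by (auto simp: exact_colorings_def)
      fix x assume x: "x \<in> V"
      have "h (a x) = h (b x)" using fun_cong[OF ab, of x] x by (simp add: g_def)
      moreover have "a x \<in> S" "b x \<in> S" using a b x by (auto simp: exact_colorings_def)
      ultimately show "a x = b x" using h by (meson bij_betw_imp_inj_on inj_onD)
    qed
  qed
  have "g ` exact_colorings V E S \<subseteq> exact_colorings V E T"
  proof
    fix y assume "y \<in> g ` exact_colorings V E S"
    then obtain a where a: "a \<in> V \<rightarrow>\<^sub>E S" "a ` V = S" "\<forall>e\<in>E. card (a ` e) \<ge> 2" and y: "y = g a"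
      by (auto simp: exact_colorings_def)
    have im: "y ` e = h ` (a ` e)" if "e \<subseteq> V" for e
      using that by (auto simp: y g_def image_iff)
    have yV: "y ` V = T" using im[of V] a h by (simp add: bij_betw_def)
    have "y \<in> V \<rightarrow>\<^sub>E T" using yV by (auto simp: y g_def)
    moreover have "card (y ` e) \<ge> 2" if e: "e \<in> E" for e
    proof -
      have eV: "e \<subseteq> V" using H e by (auto simp: hypergraph_def)
      have "inj_on h (a ` e)"
        using h a(2) eV by (metis bij_betw_imp_inj_on image_mono inj_on_subset)
      then show ?thesis using a e by (simp add: im[OF eV] card_image)
    qed
    ultimately show "y \<in> exact_colorings V E T" using yV by (auto simp: exact_colorings_def)
  qed
  then show ?thesis using inj finT by (metis card_inj_on_le)
qed

lemma card_weak_proper_colorings: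
  assumes H: "hypergraph V E"
  shows "card (weak_proper_colorings V E k) =
    (\<Sum>j\<le>card V. (k choose j) * card (exact_colorings V E {1..j}))"
proof -
  have finV: "finite V" using H by (simp add: hypergraph_def)
  have un: "weak_proper_colorings V E k = (\<Union>S\<in>Pow {1..k}. exact_colorings V E S)"
  proof (intro equalityI subsetI)
    fix \<phi> assume "\<phi> \<in> weak_proper_colorings V E k"
    then have "\<phi> \<in> exact_colorings V E (\<phi> ` V)" "\<phi> ` V \<in> Pow {1..k}"
      by (auto simp: weak_proper_colorings_def exact_colorings_def PiE_iff)
    then show "\<phi> \<in> (\<Union>S\<in>Pow {1..k}. exact_colorings V E S)" by blast
  next
    fix \<phi> assume "\<phi> \<in> (\<Union>S\<in>Pow {1..k}. exact_colorings V E S)"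
    then show "\<phi> \<in> weak_proper_colorings V E k"
      by (auto simp: weak_proper_colorings_def exact_colorings_def PiE_iff)
  qed
  have finS: "finite (exact_colorings V E S)" if "S \<in> Pow {1..k}" for S
  proof -
    have "finite S" using that finite_subset by auto
    then show ?thesis using finV unfolding exact_colorings_def
      by (simp add: finite_PiE)
  qed
  have exq: "card (exact_colorings V E S) = card (exact_colorings V E {1..card S})"
    if "S \<in> Pow {1..k}" for S
  proof -
    have "finite S" using that finite_subset by auto
    then show ?thesis using card_exact_colorings_le[OF H] by (intro antisym) auto
  qed
  have zero: "exact_colorings V E {1..j} = {}" if "j > card V" for j
  proof -
    have False if "\<phi> ` V = {1..j}" for \<phi> :: "'a \<Rightarrow> nat"
      using card_image_le[OF finV, of \<phi>] that \<open>j > card V\<close> by simp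
    then show ?thesis by (auto simp: exact_colorings_def)
  qed
  have "card (weak_proper_colorings V E k) = (\<Sum>S\<in>Pow {1..k}. card (exact_colorings V E S))"
    unfolding un using finS
    by (intro card_UN_disjoint) (auto simp: exact_colorings_def)
  also have "\<dots> = (\<Sum>S\<in>Pow {1..k}. card (exact_colorings V E {1..card S}))"
    using exq by (intro sum.cong) auto
  also have "\<dots> = (\<Sum>j\<le>k. \<Sum>S\<in>{S\<in>Pow {1..k}. card S = j}. card (exact_colorings V E {1..card S}))"
  proof (rule sum.group[symmetric])
    show "card ` Pow {1..k} \<subseteq> {..k}"
      using card_mono[of "{1..k}"] by fastforce
  qed auto
  also have "\<dots> = (\<Sum>j\<le>k. (k choose j) * card (exact_colorings V E {1..j}))"
  proof (intro sum.cong refl)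
    fix j
    have "card {S\<in>Pow {1..k}. card S = j} = (k choose j)"
      using n_subsets[of "{1..k}" j] by (simp add: Pow_def)
    then show "(\<Sum>S\<in>{S\<in>Pow {1..k}. card S = j}. card (exact_colorings V E {1..card S})) =
        (k choose j) * card (exact_colorings V E {1..j})"
      by simp
  qed
  also have "\<dots> = (\<Sum>j\<le>max k (card V). (k choose j) * card (exact_colorings V E {1..j}))"
    by (intro sum.mono_neutral_left) (auto simp: binomial_eq_0)
  also have "\<dots> = (\<Sum>j\<le>card V. (k choose j) * card (exact_colorings V E {1..j}))"
    using zero by (intro sum.mono_neutral_right) auto
  finally show ?thesis .
qed

lemma chromatic_poly_unique:
  fixes p q :: "real poly"
  assumes "\<forall>k::nat. k > 0 \<longrightarrow> poly p (real k) = f k"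
    and "\<forall>k::nat. k > 0 \<longrightarrow> poly q (real k) = f k"
  shows "p = q"
proof (rule ccontr)
  assume "p \<noteq> q"
  then have "finite {x. poly (p - q) x = 0}" by (intro poly_roots_finite) simp
  moreover have "real ` {0<..} \<subseteq> {x. poly (p - q) x = 0}" using assms by auto
  ultimately have "finite (real ` {0<..})" by (rule finite_subset[rotated])
  then have "finite {0::nat<..}" by (rule finite_imageD) simp
  then show False using infinite_Ioi by blast
qed

lemma chromatic_poly_exists:
  assumes H: "hypergraph V E"
  shows "\<exists>p::real poly. (\<forall>k::nat. poly p (real k) = real (card (weak_proper_colorings V E k)))"
proof -
  define b :: "nat \<Rightarrow> real poly" where
    "b j = smult (inverse (fact j)) (\<Prod>i<j. [:- of_nat i, 1:])" for j
  have b: "poly (b j) (real k) = real (k choose j)" for j k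
    by (simp add: b_def poly_prod binomial_gbinomial gbinomial_prod_rev field_simps
        atLeast0LessThan of_nat_gbinomial)
  show ?thesis
    by (rule exI[of _ "\<Sum>j\<le>card V. smult (real (card (exact_colorings V E {1..j}))) (b j)"])
      (simp add: poly_sum b card_weak_proper_colorings[OF H] mult.commute)
qed

theorem poly_chromatic_poly:
  assumes H: "hypergraph V E"
  shows "poly (chromatic_poly V E) (real k) = real (card (weak_proper_colorings V E k))"
proof -
  obtain p :: "real poly" where
    p: "\<forall>k::nat. poly p (real k) = real (card (weak_proper_colorings V E k))"
    using chromatic_poly_exists[OF H] by blast
  have "chromatic_poly V E = p"
    unfolding chromatic_poly_def
  proof (rule the_equality)
    show "\<forall>k::nat. k > 0 \<longrightarrow> poly p (real k) = real (card (weak_proper_colorings V E k))"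
      using p by simp
    show "q = p" if "\<forall>k::nat. k > 0 \<longrightarrow> poly q (real k) = real (card (weak_proper_colorings V E k))" for q
      using chromatic_poly_unique[OF that] p by simp
  qed
  then show ?thesis using p by simp
qed

theorem chromatic_quotient_exact:
  assumes H: "hypergraph V E" and "V \<noteq> {}"
  shows "[:0, 1:] * chromatic_quotient V E = chromatic_poly V E"
proof -
  have "weak_proper_colorings V E 0 = {}"
    using \<open>V \<noteq> {}\<close> by (auto simp: weak_proper_colorings_def PiE_eq_empty_iff)
  then have "poly (chromatic_poly V E) 0 = 0"
    using poly_chromatic_poly[OF H, of 0] by simp
  then have "[:0, 1:] dvd chromatic_poly V E"
    using poly_eq_0_iff_dvd[of "chromatic_poly V E" 0] by simp
  then show ?thesis
    unfolding chromatic_quotient_def by (rule dvd_mult_div_cancel)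
qed

end

theory Submission
  imports Defs
begin

text \<open>
  An edge of size other than 2 that contains an edge of size 2 imposes no condition on colorings
  and can be dropped. Any other edge \<open>e\<close> is removed by deletion-contraction,
  \<open>P(H) = P(H - e) - P(H / e)\<close>. Contracting an even edge changes the parity of the number of
  vertices, so both terms contribute to \<open>(-1)^(|V|+1) Q\<close> with the same sign. An edge meeting \<open>e\<close> in
  at least two vertices forms a cycle with \<open>e\<close>, hence contains an edge of size 2 after the contraction;
  so the class is stable under contraction once edges containing an edge of size 2 are
  allowed to have odd size. For a connected graph, some vertex is not a cut vertex: if it is a leaf,
  it contributes a factor \<open>x - 1\<close>, otherwise an edge at it can be deleted and contracted without
  losing connectedness. Every step decreases the number of edges.
\<close>

section \<open>Notions for the induction\<close>

definition contains_edge2 :: "'a set set \<Rightarrow> 'a set \<Rightarrow> bool" where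
  "contains_edge2 E A \<longleftrightarrow> (\<exists>u\<in>A. \<exists>v\<in>A. u \<noteq> v \<and> {u, v} \<in> E)"

text \<open>Connectedness through edges of size 2, expressed by cuts: a crossing pair
  \<open>{x, y}\<close> has two elements automatically. Preimages of cuts under a contraction are
  again cuts. Edges leaving \<open>V\<close> are ignored, so \<open>E\<close> can stay fixed while
  \<open>V\<close> shrinks.\<close>

definition cut_connected :: "'a set \<Rightarrow> 'a set set \<Rightarrow> bool" where
  "cut_connected V E \<longleftrightarrow>
     V \<noteq> {} \<and> (\<forall>S. S \<noteq> {} \<longrightarrow> S \<subset> V \<longrightarrow> (\<exists>x\<in>S. \<exists>y\<in>V - S. {x, y} \<in> E))"

text \<open>The induction invariant. Contracting an even edge can make another edge odd, but then
  that edge acquires an edge of size 2 inside it.\<close>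

definition weak_L0' :: "'a set \<Rightarrow> 'a set set \<Rightarrow> bool" where
  "weak_L0' V E \<longleftrightarrow>
     hypergraph V E \<and> cut_connected V E \<and>
     (\<forall>f\<in>E. even (card f) \<or> contains_edge2 E f) \<and>
     (\<forall>vs es. hypercycle V E vs es \<longrightarrow> contains_edge2 E (\<Union>(set es)))"

text \<open>The set \<open>e\<close> is collapsed onto a representative \<open>w\<close>, meant to
  lie in \<open>e\<close>, so that no fresh vertex is required. Edges with equal images merge, which
  is harmless since they impose the same condition on colorings.\<close>

definition contract :: "'a set \<Rightarrow> 'a \<Rightarrow> 'a \<Rightarrow> 'a" where
  "contract e w x = (if x \<in> e then w else x)"

definition alternating :: "'a set \<Rightarrow> 'a set set \<Rightarrow> bool" where
  "alternating V E \<longleftrightarrow> (\<forall>x::real. 0 \<le> x \<and> x < 1 \<longrightarrow>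
     (-1) ^ (card V + 1) * poly (chromatic_quotient V E) x > 0)"

subsection \<open>Chromatic polynomials\<close>

lemma finite_weak_proper_colorings: "finite V \<Longrightarrow> finite (weak_proper_colorings V E k)"
  unfolding weak_proper_colorings_def by (simp add: finite_PiE)

lemma hypergraph_finite_edges: "hypergraph V E \<Longrightarrow> finite E"
  unfolding hypergraph_def by (auto intro: finite_subset[of _ "Pow V"])

text \<open>A polynomial is determined by its values at the positive integers, so identities of
  chromatic polynomials reduce to counting colorings.\<close>

lemma chromatic_poly_eqI:
  assumes "hypergraph V E"
    and "\<And>k. k > 0 \<Longrightarrow> poly p (real k) = real (card (weak_proper_colorings V E k))"
  shows "chromatic_poly V E = p"
  by (rule chromatic_poly_unique[where f = "\<lambda>k. real (card (weak_proper_colorings V E k))"])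
    (use assms poly_chromatic_poly in auto)

lemma two_le_card_image:
  assumes "finite A" "u \<in> A" "v \<in> A" "f u \<noteq> f v"
  shows "2 \<le> card (f ` A)"
proof -
  have "card {f u, f v} \<le> card (f ` A)"
    using assms by (intro card_mono) auto
  then show ?thesis using assms by simp
qed

lemma two_le_card_doubleton_image: "2 \<le> card (f ` {u, v}) \<longleftrightarrow> f u \<noteq> f v"
  by (cases "f u = f v") auto

text \<open>An edge \<open>{u, v}\<close> inside \<open>e\<close> already forces two colors on
  \<open>e\<close>. Since \<open>card e\<close> is not 2, it differs from \<open>e\<close> and
  survives the deletion.\<close>

lemma chromatic_quotient_delete_redundant:
  assumes H: "hypergraph V E" and e: "e \<in> E" "card e \<noteq> 2" "contains_edge2 E e"
  shows "chromatic_quotient V (E - {e}) = chromatic_quotient V E"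
proof -
  obtain u v where uv: "u \<in> e" "v \<in> e" "u \<noteq> v" "{u, v} \<in> E"
    using e by (auto simp: contains_edge2_def)
  have fin: "finite e" using H e by (auto simp: hypergraph_def intro: finite_subset)
  have uvE: "{u, v} \<in> E - {e}" using uv e(2) by auto
  have "card (\<phi> ` e) \<ge> 2" if "\<forall>g\<in>E - {e}. card (\<phi> ` g) \<ge> 2" for \<phi> :: "'a \<Rightarrow> nat"
  proof -
    have "\<phi> u \<noteq> \<phi> v" using that uvE two_le_card_doubleton_image by metis
    then show ?thesis using two_le_card_image fin uv by metis
  qed
  then have "weak_proper_colorings V (E - {e}) k = weak_proper_colorings V E k" for k
    unfolding weak_proper_colorings_def by blast
  then show ?thesis by (simp add: chromatic_quotient_def chromatic_poly_def)
qed

section \<open>Deletion-contraction and pendant vertices\<close>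

lemma hypergraph_contract:
  assumes "hypergraph V E"
  shows "hypergraph (contract e w ` V) ((`) (contract e w) ` (E - {e}))"
  using assms unfolding hypergraph_def by auto

text \<open>All vertices of \<open>e\<close> become one. The additive form avoids truncated
  subtraction.\<close>

lemma card_contract:
  assumes "finite V" "e \<subseteq> V" "w \<in> e"
  shows "card (contract e w ` V) + card e = card V + 1"
proof -
  have "contract e w ` V = insert w (V - e)"
    using assms by (auto simp: contract_def)
  moreover have "card (V - e) + card e = card V"
    using assms by (metis Diff_partition Diff_disjoint card_Un_disjoint finite_Diff finite_subset
        inf_commute add.commute)
  ultimately show ?thesis using assms by simp
qed

text \<open>A coloring proper on all edges but \<open>e\<close> is either proper on \<open>e\<close>
  too or constant on \<open>e\<close>; the constant ones correspond to colorings of the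
  contraction.\<close>

lemma card_weak_proper_colorings_contract:
  assumes H: "hypergraph V E" and e: "e \<in> E" "w \<in> e"
  shows "card (weak_proper_colorings V (E - {e}) k) = card (weak_proper_colorings V E k) +
    card (weak_proper_colorings (contract e w ` V) ((`) (contract e w) ` (E - {e})) k)"
proof -
  let ?c = "contract e w"
  let ?B = "weak_proper_colorings (?c ` V) ((`) ?c ` (E - {e})) k"
  let ?C = "{\<phi> \<in> weak_proper_colorings V (E - {e}) k. \<forall>x\<in>e. \<phi> x = \<phi> w}"
  have finV: "finite V" and eV: "e \<subseteq> V" using H e by (auto simp: hypergraph_def)
  have fine: "finite e" using finV eV finite_subset by blast
  have EV: "\<And>g. g \<in> E \<Longrightarrow> g \<subseteq> V" using H by (auto simp: hypergraph_def)
  have cV: "?c x \<in> V" if "x \<in> V" for x using that eV e by (auto simp: contract_def)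
  have cc: "?c (?c x) = ?c x" for x using e by (auto simp: contract_def)
  have mono: "card (\<phi> ` e) \<ge> 2 \<longleftrightarrow> \<not> (\<forall>x\<in>e. \<phi> x = \<phi> w)" for \<phi> :: "'a \<Rightarrow> nat"
  proof
    assume "card (\<phi> ` e) \<ge> 2"
    show "\<not> (\<forall>x\<in>e. \<phi> x = \<phi> w)"
    proof
      assume "\<forall>x\<in>e. \<phi> x = \<phi> w"
      then have "\<phi> ` e \<subseteq> {\<phi> w}" by auto
      then have "card (\<phi> ` e) \<le> 1" using card_mono[of "{\<phi> w}"] by fastforce
      with \<open>card (\<phi> ` e) \<ge> 2\<close> show False by simp
    qed
  qed (use two_le_card_image[OF fine] e in metis)
  have split: "weak_proper_colorings V (E - {e}) k = weak_proper_colorings V E k \<union> ?C"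
    using mono e unfolding weak_proper_colorings_def by blast
  have disj: "weak_proper_colorings V E k \<inter> ?C = {}"
    using mono e unfolding weak_proper_colorings_def by blast
  \<comment> \<open>Composing with the contraction spreads the color of \<open>w\<close> over
    \<open>e\<close>; restricting to the contracted vertex set undoes this. The outer
    \<open>restrict\<close> keeps both maps extensional.\<close>
  have "bij_betw (\<lambda>\<phi>. restrict (\<phi> \<circ> ?c) V) ?B ?C"
  proof (rule bij_betw_byWitness[where f' = "\<lambda>\<phi>. restrict \<phi> (?c ` V)"])
    show "\<forall>\<phi>\<in>?B. restrict (restrict (\<phi> \<circ> ?c) V) (?c ` V) = \<phi>"
    proof
      fix \<phi> assume "\<phi> \<in> ?B"
      then have "\<phi> \<in> ?c ` V \<rightarrow>\<^sub>E {1..k}" by (simp add: weak_proper_colorings_def)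
      then have "\<phi> x = undefined" if "x \<notin> ?c ` V" for x using that by (meson PiE_arb)
      then show "restrict (restrict (\<phi> \<circ> ?c) V) (?c ` V) = \<phi>"
        using cc cV by (intro ext) (auto simp: restrict_def)
    qed
    show "\<forall>\<phi>\<in>?C. restrict (restrict \<phi> (?c ` V) \<circ> ?c) V = \<phi>"
    proof
      fix \<phi> assume C: "\<phi> \<in> ?C"
      then have "\<phi> \<in> V \<rightarrow>\<^sub>E {1..k}" by (simp add: weak_proper_colorings_def)
      then have "\<phi> x = undefined" if "x \<notin> V" for x using that by (meson PiE_arb)
      moreover have "\<phi> (?c x) = \<phi> x" for x using C by (auto simp: contract_def)
      ultimately show "restrict (restrict \<phi> (?c ` V) \<circ> ?c) V = \<phi>"
        by (auto simp: fun_eq_iff)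
    qed
    show "(\<lambda>\<phi>. restrict (\<phi> \<circ> ?c) V) ` ?B \<subseteq> ?C"
    proof
      fix \<psi> assume "\<psi> \<in> (\<lambda>\<phi>. restrict (\<phi> \<circ> ?c) V) ` ?B"
      then obtain \<phi> where \<phi>: "\<phi> \<in> ?B" and \<psi>: "\<psi> = restrict (\<phi> \<circ> ?c) V" by blast
      \<comment> \<open>An edge and its contraction receive the same set of colors, so the edge
        conditions transfer.\<close>
      have im: "\<psi> ` g = \<phi> ` ?c ` g" if "g \<in> E" for g
        using EV[OF that] by (auto simp: \<psi> image_iff subset_iff)
      have "\<psi> \<in> V \<rightarrow>\<^sub>E {1..k}" using \<phi> by (auto simp: \<psi> weak_proper_colorings_def PiE_iff)
      moreover have "\<forall>g\<in>E - {e}. card (\<psi> ` g) \<ge> 2"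
        using \<phi> im by (simp add: weak_proper_colorings_def)
      moreover have "\<forall>x\<in>e. \<psi> x = \<psi> w" using eV e by (auto simp: \<psi> contract_def)
      ultimately show "\<psi> \<in> ?C" by (simp add: weak_proper_colorings_def)
    qed
    show "(\<lambda>\<phi>. restrict \<phi> (?c ` V)) ` ?C \<subseteq> ?B"
    proof
      fix \<psi> assume "\<psi> \<in> (\<lambda>\<phi>. restrict \<phi> (?c ` V)) ` ?C"
      then obtain \<phi> where \<phi>: "\<phi> \<in> ?C" and \<psi>: "\<psi> = restrict \<phi> (?c ` V)" by blast
      have \<phi>c: "\<phi> (?c x) = \<phi> x" for x using \<phi> by (auto simp: contract_def)
      have im: "\<psi> ` ?c ` g = \<phi> ` g" if "g \<in> E" for g
      proof -
        have "\<psi> (?c x) = \<phi> x" if "x \<in> g" for x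
          using EV[OF \<open>g \<in> E\<close>] that \<phi>c by (auto simp: \<psi>)
        then show ?thesis by (simp add: image_image)
      qed
      have "\<psi> \<in> ?c ` V \<rightarrow>\<^sub>E {1..k}"
        using \<phi> cV by (auto simp: \<psi> weak_proper_colorings_def PiE_iff)
      moreover have "\<forall>g\<in>(`) ?c ` (E - {e}). card (\<psi> ` g) \<ge> 2"
        using \<phi> im by (simp add: weak_proper_colorings_def)
      ultimately show "\<psi> \<in> ?B" by (simp add: weak_proper_colorings_def)
    qed
  qed
  then have "card ?B = card ?C" by (rule bij_betw_same_card)
  moreover have "card (weak_proper_colorings V (E - {e}) k) = card (weak_proper_colorings V E k) + card ?C"
    unfolding split[symmetric]
    by (subst split) (use finV disj in \<open>intro card_Un_disjoint, auto simp: finite_weak_proper_colorings\<close>)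
  ultimately show ?thesis by simp
qed

lemma alternating_delete_contract:
  assumes H: "hypergraph V E" and e: "e \<in> E" "w \<in> e" "even (card e)"
    and del: "alternating V (E - {e})"
    and con: "alternating (contract e w ` V) ((`) (contract e w) ` (E - {e}))"
  shows "alternating V E"
proof -
  let ?V = "contract e w ` V" and ?E = "(`) (contract e w) ` (E - {e})"
  have H1: "hypergraph V (E - {e})" using H by (auto simp: hypergraph_def)
  have "chromatic_poly V E = chromatic_poly V (E - {e}) - chromatic_poly ?V ?E"
    by (rule chromatic_poly_eqI[OF H])
      (simp add: poly_chromatic_poly H1 hypergraph_contract[OF H]
        card_weak_proper_colorings_contract[OF H e(1,2)])
  moreover have "V \<noteq> {}" using H e by (auto simp: hypergraph_def)
  \<comment> \<open>Exactness of the division is available as a product with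
    \<open>[:0, 1:]\<close>, so the recurrence is first stated with this factor, which is then
    cancelled.\<close>
  ultimately have "[:0, 1:] * chromatic_quotient V E =
      [:0, 1:] * (chromatic_quotient V (E - {e}) - chromatic_quotient ?V ?E)"
    by (simp only: chromatic_quotient_exact H H1 hypergraph_contract[OF H] right_diff_distrib
        image_is_empty not_False_eq_True)
  then have Q: "chromatic_quotient V E = chromatic_quotient V (E - {e}) - chromatic_quotient ?V ?E"
    by (simp only: mult_cancel_left) auto
  have "card ?V + card e = card V + 1"
    using H e by (intro card_contract) (auto simp: hypergraph_def)
  \<comment> \<open>As \<open>card e\<close> is even, contraction flips the parity of the vertex
    count; this absorbs the minus sign of the recurrence.\<close>
  then have "even (card V) \<longleftrightarrow> odd (card ?V)" using e(3) by (metis even_add odd_one)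
  then have "(-1::real) ^ (card V + 1) = - ((-1) ^ (card ?V + 1))"
    by (cases "even (card V)") auto
  then have "(-1) ^ (card V + 1) * poly (chromatic_quotient V E) x =
      (-1) ^ (card V + 1) * poly (chromatic_quotient V (E - {e})) x +
      (-1) ^ (card ?V + 1) * poly (chromatic_quotient ?V ?E) x" for x
    by (simp only: Q poly_diff right_diff_distrib)
  then show ?thesis
    using del con unfolding alternating_def by (metis add_pos_pos)
qed

text \<open>The new vertex may take any color but that of \<open>u\<close>, which gives the factor
  \<open>x - 1\<close>. The additional vertex flips the sign, and the resulting factor
  \<open>1 - x\<close> is positive because \<open>x < 1\<close>.\<close>

lemma alternating_leaf:
  assumes H: "hypergraph V E" and u: "u \<in> V" and v: "v \<notin> V" and alt: "alternating V E"
  shows "alternating (insert v V) (insert {u, v} E)"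
proof -
  let ?V = "insert v V" and ?E = "insert {u, v} E"
  have H': "hypergraph ?V ?E" using H u by (auto simp: hypergraph_def)
  have finV: "finite V" using H by (simp add: hypergraph_def)
  have card_eq: "card (weak_proper_colorings ?V ?E k) = card (weak_proper_colorings V E k) * (k - 1)" for k
  proof -
    let ?S = "SIGMA \<phi>:weak_proper_colorings V E k. {1..k} - {\<phi> u}"
    have "bij_betw (\<lambda>(\<phi>, c). \<phi>(v := c)) ?S (weak_proper_colorings ?V ?E k)"
    \<comment> \<open>A coloring of the larger hypergraph is split into its part on \<open>V\<close>
      and its color at \<open>v\<close>. Resetting \<open>v\<close> to \<open>undefined\<close>
      makes the first part extensional on \<open>V\<close>.\<close>
    proof (rule bij_betw_byWitness[where f' = "\<lambda>\<psi>. (\<psi>(v := undefined), \<psi> v)"])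
      have im: "(\<phi>(v := c)) ` g = \<phi> ` g" if "g \<in> E" for g and c and \<phi> :: "'a \<Rightarrow> nat"
        using that H v by (auto simp: hypergraph_def image_iff)
      show "\<forall>a\<in>?S. (((\<lambda>(\<phi>, c). \<phi>(v := c)) a)(v := undefined), ((\<lambda>(\<phi>, c). \<phi>(v := c)) a) v) = a"
        using v by (auto simp: weak_proper_colorings_def PiE_iff extensional_def fun_eq_iff)
      show "\<forall>a\<in>weak_proper_colorings ?V ?E k. (\<lambda>(\<phi>, c). \<phi>(v := c)) (a(v := undefined), a v) = a"
        by auto
      show "(\<lambda>(\<phi>, c). \<phi>(v := c)) ` ?S \<subseteq> weak_proper_colorings ?V ?E k"
      proof
        fix \<psi> assume "\<psi> \<in> (\<lambda>(\<phi>, c). \<phi>(v := c)) ` ?S"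
        then obtain \<phi> c where "(\<phi>, c) \<in> ?S" and \<psi>: "\<psi> = \<phi>(v := c)" by (auto simp del: mem_Sigma_iff)
        then have p: "\<phi> \<in> weak_proper_colorings V E k" "c \<in> {1..k}" "c \<noteq> \<phi> u" by auto
        have "\<psi> \<in> ?V \<rightarrow>\<^sub>E {1..k}"
          using p by (auto simp: \<psi> weak_proper_colorings_def PiE_iff extensional_def)
        moreover have "card (\<psi> ` g) \<ge> 2" if "g \<in> E" for g
          using p that im unfolding \<psi> weak_proper_colorings_def by simp
        moreover have "card (\<psi> ` {u, v}) \<ge> 2"
          unfolding two_le_card_doubleton_image using p u v by (auto simp: \<psi>)
        ultimately show "\<psi> \<in> weak_proper_colorings ?V ?E k"
          unfolding weak_proper_colorings_def by blast
      qed
      show "(\<lambda>\<psi>. (\<psi>(v := undefined), \<psi> v)) ` weak_proper_colorings ?V ?E k \<subseteq> ?S"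
      proof
        fix a assume "a \<in> (\<lambda>\<psi>. (\<psi>(v := undefined), \<psi> v)) ` weak_proper_colorings ?V ?E k"
        then obtain \<psi> where p: "\<psi> \<in> weak_proper_colorings ?V ?E k"
          and a: "a = (\<psi>(v := undefined), \<psi> v)" by auto
        have "\<psi>(v := undefined) \<in> V \<rightarrow>\<^sub>E {1..k}"
          using p v by (auto simp: weak_proper_colorings_def PiE_iff extensional_def)
        moreover have "card (\<psi>(v := undefined) ` g) \<ge> 2" if "g \<in> E" for g
          using p that im unfolding weak_proper_colorings_def by simp
        moreover have "\<psi> u \<noteq> \<psi> v"
          using p unfolding weak_proper_colorings_def
          by (metis (lifting) insertI1 mem_Collect_eq two_le_card_doubleton_image)
        moreover have "\<psi> v \<in> {1..k}" using p by (auto simp: weak_proper_colorings_def PiE_iff)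
        ultimately show "a \<in> ?S" using u v unfolding a weak_proper_colorings_def by auto
      qed
    qed
    then have "card (weak_proper_colorings ?V ?E k) = card ?S" by (metis bij_betw_same_card)
    also have "\<dots> = (\<Sum>\<phi>\<in>weak_proper_colorings V E k. card ({1..k} - {\<phi> u}))"
      by (rule card_SigmaI) (simp_all add: finite_weak_proper_colorings finV)
    also have "\<dots> = (\<Sum>\<phi>\<in>weak_proper_colorings V E k. k - 1)"
    proof (rule sum.cong[OF refl])
      fix \<phi> assume "\<phi> \<in> weak_proper_colorings V E k"
      then have "\<phi> u \<in> {1..k}" using u by (auto simp: weak_proper_colorings_def)
      then show "card ({1..k} - {\<phi> u}) = k - 1" by (simp add: card_Diff_singleton)
    qed
    finally show ?thesis by simp
  qed
  have "chromatic_poly ?V ?E = [:-1, 1:] * chromatic_poly V E"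
    by (rule chromatic_poly_eqI[OF H'])
      (simp add: poly_chromatic_poly[OF H] card_eq of_nat_diff algebra_simps)
  then have "[:0, 1:] * chromatic_quotient ?V ?E = [:0, 1:] * ([:-1, 1:] * chromatic_quotient V E)"
    using chromatic_quotient_exact[OF H'] chromatic_quotient_exact[OF H] u
    by (metis empty_iff insert_not_empty mult.left_commute)
  then have "chromatic_quotient ?V ?E = [:-1, 1:] * chromatic_quotient V E"
    by (simp only: mult_cancel_left) auto
  then have "(-1) ^ (card ?V + 1) * poly (chromatic_quotient ?V ?E) x =
      (1 - x) * ((-1) ^ (card V + 1) * poly (chromatic_quotient V E) x)" for x
    using finV v by (simp del: mult_pCons_left add: poly_mult) (simp add: algebra_simps)
  then show ?thesis using alt unfolding alternating_def by (simp del: power_Suc add: mult_pos_pos)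
qed

lemma alternating_single_vertex: "alternating {v} {}"
proof -
  have H: "hypergraph {v} {}" by (simp add: hypergraph_def)
  have "chromatic_poly {v} {} = [:0, 1:]"
    by (rule chromatic_poly_eqI[OF H]) (simp add: weak_proper_colorings_def card_PiE)
  then have "chromatic_quotient {v} {} = 1" by (simp add: chromatic_quotient_def)
  then show ?thesis by (simp add: alternating_def)
qed

subsection \<open>Connectedness\<close>

text \<open>Serves to discard edges that are not of size 2 or not inside \<open>V\<close>, as these
  never cross a cut.\<close>

lemma cut_connected_mono:
  assumes "cut_connected V E" "\<And>x y. x \<in> V \<Longrightarrow> y \<in> V \<Longrightarrow> x \<noteq> y \<Longrightarrow> {x, y} \<in> E \<Longrightarrow> {x, y} \<in> F"
  shows "cut_connected V F"
  unfolding cut_connected_def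
proof (intro conjI allI impI)
  show "V \<noteq> {}" using assms(1) by (simp add: cut_connected_def)
  fix S assume S: "S \<noteq> {}" "S \<subset> V"
  then obtain x y where "x \<in> S" "y \<in> V - S" "{x, y} \<in> E"
    using assms(1) unfolding cut_connected_def by meson
  then show "\<exists>x\<in>S. \<exists>y\<in>V - S. {x, y} \<in> F" using assms(2)[of x y] S by blast
qed

lemma cut_connected_insert:
  assumes "cut_connected V E" "u \<in> V" "{u, v} \<in> E"
  shows "cut_connected (insert v V) E"
  unfolding cut_connected_def
proof (intro conjI allI impI)
  fix S assume S: "S \<noteq> {}" "S \<subset> insert v V"
  show "\<exists>x\<in>S. \<exists>y\<in>insert v V - S. {x, y} \<in> E"
  \<comment> \<open>Either the cut separates \<open>v\<close> from all of \<open>V\<close>, and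
    \<open>{u, v}\<close> crosses it, or its trace on \<open>V\<close> is a proper cut of
    \<open>V\<close>.\<close>
  proof (cases "V \<inter> S = {} \<or> V \<subseteq> S")
    case True
    then show ?thesis
    proof
      assume "V \<inter> S = {}"
      then have "v \<in> S" "u \<notin> S" using S assms by auto
      moreover have "{v, u} \<in> E" using assms by (simp add: insert_commute)
      ultimately show ?thesis using assms(2) by blast
    next
      assume "V \<subseteq> S"
      then have "v \<notin> S" "u \<in> S" using S assms by auto
      then show ?thesis using assms by auto
    qed
  next
    case False
    then have "\<exists>x\<in>V \<inter> S. \<exists>y\<in>V - V \<inter> S. {x, y} \<in> E"
      using assms(1) unfolding cut_connected_def by (metis Int_lower1 inf.orderE psubsetI Int_lower2)
    then show ?thesis by blast
  qed
qed simp

text \<open>The preimage of a cut is a cut of \<open>V\<close>. An edge crossing it has ends with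
  different images, hence is not \<open>e\<close>, and its image crosses the given cut.\<close>

lemma cut_connected_contract:
  assumes "cut_connected V E"
  shows "cut_connected (contract e w ` V) ((`) (contract e w) ` (E - {e}))"
  unfolding cut_connected_def
proof (intro conjI allI impI)
  let ?c = "contract e w"
  show "?c ` V \<noteq> {}" using assms by (simp add: cut_connected_def)
  fix S assume S: "S \<noteq> {}" "S \<subset> ?c ` V"
  let ?T = "{x \<in> V. ?c x \<in> S}"
  have "?T \<noteq> {}" "?T \<subset> V" using S by auto
  then obtain x y where xy: "x \<in> ?T" "y \<in> V - ?T" "{x, y} \<in> E"
    using assms unfolding cut_connected_def by meson
  then have "?c x \<noteq> ?c y" by auto
  then have "{x, y} \<noteq> e" by (auto simp: contract_def)
  then have "{?c x, ?c y} \<in> (`) ?c ` (E - {e})" using xy(3) by (intro image_eqI[of _ _ "{x, y}"]) auto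
  moreover have "?c x \<in> S" "?c y \<in> ?c ` V - S" using xy by auto
  ultimately show "\<exists>x\<in>S. \<exists>y\<in>?c ` V - S. {x, y} \<in> (`) ?c ` (E - {e})" by blast
qed

text \<open>A path from inside \<open>S\<close> to outside must leave \<open>S\<close> along some
  edge; otherwise induction along the path would keep its end in \<open>S\<close>.\<close>

lemma connected2_imp_cut_connected:
  assumes H: "hypergraph V E" and conn: "connected2 V E"
  shows "cut_connected V E"
  unfolding cut_connected_def
proof (intro conjI allI impI)
  show "V \<noteq> {}" using conn by (simp add: connected2_def)
  fix S assume S: "S \<noteq> {}" "S \<subset> V"
  then obtain a b where ab: "a \<in> S" "b \<in> V - S" by blast
  then have "(a, b) \<in> {(x, y). {x, y} \<in> edges2 E}\<^sup>*"
    using conn S unfolding connected2_def by blast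
  then have "b \<in> S" if "\<And>x y. x \<in> S \<Longrightarrow> {x, y} \<in> E \<Longrightarrow> y \<in> S"
    by (induction rule: rtrancl_induct) (use ab that in \<open>auto simp: edges2_def\<close>)
  then have "\<not> (\<forall>x y. x \<in> S \<longrightarrow> {x, y} \<in> E \<longrightarrow> y \<in> S)" using ab by (metis DiffD2)
  then obtain x y where xy: "x \<in> S" "{x, y} \<in> E" "y \<notin> S" unfolding not_all not_imp by (elim exE conjE)
  then have "{x, y} \<subseteq> V" using H unfolding hypergraph_def by (metis (full_types))
  with xy show "\<exists>x\<in>S. \<exists>y\<in>V - S. {x, y} \<in> E" by blast
qed

text \<open>A maximal proper connected subset misses exactly one vertex.\<close>

lemma exists_non_cut_vertex:
  assumes conn: "cut_connected V E" and fin: "finite V" and card: "card V \<ge> 2"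
  shows "\<exists>v\<in>V. cut_connected (V - {v}) E"
proof -
  let ?F = "{S. S \<subset> V \<and> cut_connected S E}"
  obtain a where a: "a \<in> V" using card by fastforce
  \<comment> \<open>A singleton has no cuts; it starts the search for a maximal set.\<close>
  have "cut_connected {a} E" by (auto simp: cut_connected_def)
  moreover have "{a} \<subset> V" using a card by (metis card.empty card_insert_disjoint empty_iff
        empty_subsetI finite.emptyI insert_subset not_less_eq_eq numeral_2_eq_2 order_refl psubsetI)
  ultimately have "{a} \<in> ?F" by simp
  moreover have "finite ?F" using fin by (auto intro: finite_subset[of _ "Pow V"])
  ultimately have "\<exists>S\<in>?F. {a} \<subseteq> S \<and> (\<forall>T\<in>?F. S \<subseteq> T \<longrightarrow> S = T)"
    by (intro finite_has_maximal2)
  then obtain S where S: "S \<in> ?F" "{a} \<subseteq> S" and max: "\<forall>T\<in>?F. S \<subseteq> T \<longrightarrow> S = T" by (elim bexE conjE)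
  have "S \<noteq> {}" "S \<subset> V" using S by auto
  then obtain x y where xy: "x \<in> S" "y \<in> V - S" "{x, y} \<in> E"
    using conn unfolding cut_connected_def by meson
  \<comment> \<open>Attaching \<open>y\<close> along a crossing edge preserves connectedness, so by
    maximality the enlarged set is no longer proper.\<close>
  have "cut_connected (insert y S) E" using S xy by (auto intro: cut_connected_insert)
  then have "insert y S = V" using bspec[OF max, of "insert y S"] S xy by blast
  then have "V - {y} = S" using xy by blast
  then show ?thesis using S xy by blast
qed

subsection \<open>Stability of the class\<close>

text \<open>In a graph, any edge of a cycle is itself an edge of size 2 inside the union of the
  cycle.\<close>

lemma weak_L0'_graph:
  assumes "hypergraph V E" "cut_connected V E" "\<forall>f\<in>E. card f = 2"
  shows "weak_L0' V E"
  unfolding weak_L0'_def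
proof (intro conjI allI impI)
  fix vs es assume C: "hypercycle V E vs es"
  then have "hd es \<in> set es" by (intro hd_in_set) (auto simp: hypercycle_def)
  moreover from this have "hd es \<in> E" using C by (auto simp: hypercycle_def)
  moreover from this obtain x y where "hd es = {x, y}" "x \<noteq> y" using assms(3) by (metis card_2_iff)
  ultimately show "contains_edge2 E (\<Union> (set es))"
    unfolding contains_edge2_def by (metis UnionI insertI1 insert_commute)
qed (use assms in auto)

lemma contains_edge2_delete:
  assumes "contains_edge2 E A" "card e \<noteq> 2"
  shows "contains_edge2 (E - {e}) A"
proof -
  obtain u v where "u \<in> A" "v \<in> A" "u \<noteq> v" "{u, v} \<in> E"
    using assms(1) by (auto simp: contains_edge2_def)
  moreover from this have "{u, v} \<noteq> e" using assms(2) by auto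
  ultimately show ?thesis unfolding contains_edge2_def by blast
qed

text \<open>All witnesses in the invariant are edges of size 2, which survive, and deletion creates
  no new cycles.\<close>

lemma weak_L0'_delete:
  assumes L: "weak_L0' V E" and e: "card e \<noteq> 2"
  shows "weak_L0' V (E - {e})"
  unfolding weak_L0'_def
proof (intro conjI allI impI)
  show "hypergraph V (E - {e})" using L by (auto simp: weak_L0'_def hypergraph_def)
  show "cut_connected V (E - {e})"
    by (rule cut_connected_mono[of V E]) (use L e in \<open>auto simp: weak_L0'_def\<close>)
  show "\<forall>f\<in>E - {e}. even (card f) \<or> contains_edge2 (E - {e}) f"
    using L e contains_edge2_delete unfolding weak_L0'_def by blast
  fix vs es assume "hypercycle V (E - {e}) vs es"
  then have "hypercycle V E vs es" by (auto simp: hypercycle_def)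
  then show "contains_edge2 (E - {e}) (\<Union> (set es))"
    using L e contains_edge2_delete unfolding weak_L0'_def by blast
qed

text \<open>As \<open>e\<close> contains no edge of size 2, such an edge has at most one end in
  \<open>e\<close>; so it differs from \<open>e\<close> and its ends stay distinct.\<close>

lemma contains_edge2_contract:
  assumes A: "contains_edge2 E A" and w: "w \<in> e" and indep: "\<not> contains_edge2 E e"
  shows "contains_edge2 ((`) (contract e w) ` (E - {e})) (contract e w ` A)"
proof -
  let ?c = "contract e w"
  obtain u v where uv: "u \<in> A" "v \<in> A" "u \<noteq> v" "{u, v} \<in> E"
    using A by (auto simp: contains_edge2_def)
  have not_both: "\<not> (u \<in> e \<and> v \<in> e)" using indep uv by (auto simp: contains_edge2_def)
  have "?c u \<noteq> ?c v" using not_both w uv(3) by (auto simp: contract_def)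
  moreover have "{?c u, ?c v} \<in> (`) ?c ` (E - {e})"
    using uv not_both by (intro image_eqI[of _ _ "{u, v}"]) auto
  ultimately show ?thesis using uv unfolding contains_edge2_def by blast
qed

section \<open>Lifting cycles through a contraction\<close>

lemma hypercycleD:
  assumes "hypercycle V E vs es"
  shows "length vs = length es" "2 \<le> length es" "set vs \<subseteq> V" "set es \<subseteq> E"
    "distinct vs" "distinct es"
    "\<And>i. i < length es \<Longrightarrow> vs ! i \<in> es ! i"
    "\<And>i. i < length es \<Longrightarrow> vs ! (Suc i mod length es) \<in> es ! i"
  using assms by (simp_all add: hypercycle_def)

text \<open>Allows the contracted vertex to be moved to index 0.\<close>

lemma hypercycle_rotate:
  assumes "hypercycle V E vs es"
  shows "hypercycle V E (rotate k vs) (rotate k es)"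
proof -
  let ?n = "length es"
  have n: "length vs = ?n" "?n \<ge> 2" using assms by (auto simp: hypercycle_def)
  have "{rotate k vs ! i, rotate k vs ! (Suc i mod ?n)} \<subseteq> rotate k es ! i" if "i < ?n" for i
  proof -
    have "(k + i) mod ?n < ?n" using n by (intro mod_less_divisor) linarith
    then have "{vs ! ((k + i) mod ?n), vs ! (Suc ((k + i) mod ?n) mod ?n)} \<subseteq> es ! ((k + i) mod ?n)"
      using assms unfolding hypercycle_def by blast
    moreover have "Suc i mod ?n < ?n" using n by (intro mod_less_divisor) linarith
    ultimately show ?thesis
      using that n by (simp add: nth_rotate mod_simps)
  qed
  then show ?thesis using assms unfolding hypercycle_def by simp
qed

lemma mem_contract_image:
  assumes "x \<in> contract e w ` A" "x \<noteq> w"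
  shows "x \<in> A" "x \<notin> e"
  using assms by (auto simp: contract_def split: if_splits)

text \<open>
  If the cycle passes through \<open>w\<close> and its two lifted edges there meet \<open>e\<close> in different vertices,
  the lifted cycle is closed by inserting \<open>e\<close>.
\<close>

lemma hypercycle_lift_contract:
  assumes e: "e \<in> E" "w \<in> e" "e \<subseteq> V"
    and C: "hypercycle (contract e w ` V) ((`) (contract e w) ` (E - {e})) vs es'"
  shows "\<exists>us es. hypercycle V E us es \<and> contract e w ` \<Union>(set es) = \<Union>(set es')"
proof -
  let ?c = "contract e w" and ?E' = "(`) (contract e w) ` (E - {e})"
  \<comment> \<open>Several edges may have the same contraction, so a lift is chosen for each
    contracted edge. Contracting the lift recovers the edge, hence distinct edges have distinct
    lifts.\<close>
  define g where "g h = (SOME f. f \<in> E - {e} \<and> ?c ` f = h)" for h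
  have g: "g h \<in> E - {e} \<and> ?c ` g h = h" if "h \<in> ?E'" for h
    unfolding g_def by (rule someI_ex) (use that in blast)
  have gE: "set (map g hs) \<subseteq> E - {e}" if "set hs \<subseteq> ?E'" for hs
  proof
    fix f assume "f \<in> set (map g hs)"
    then obtain h where "h \<in> set hs" "f = g h" by auto
    then show "f \<in> E - {e}" using g[OF subsetD[OF that]] by simp
  qed
  have g_inj: "inj_on g (set hs)" if "set hs \<subseteq> ?E'" for hs
  proof (rule inj_onI)
    fix x y assume "x \<in> set hs" "y \<in> set hs" "g x = g y"
    moreover have "?c ` g x = x" "?c ` g y = y"
      using g[OF subsetD[OF that \<open>x \<in> set hs\<close>]] g[OF subsetD[OF that \<open>y \<in> set hs\<close>]] by blast+
    ultimately show "x = y" by metis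
  qed
  have gU: "?c ` \<Union>(set (map g hs)) = \<Union>(set hs)" if "set hs \<subseteq> ?E'" for hs
  proof -
    have "?c ` g h = h" if "h \<in> set hs" for h using g[OF subsetD[OF \<open>set hs \<subseteq> ?E'\<close> that]] by (rule conjunct2)
    then show ?thesis unfolding set_map image_Union image_image by (simp cong: image_cong)
  qed
  show ?thesis
  proof (cases "w \<in> set vs")
    \<comment> \<open>Away from \<open>w\<close> the contraction changes no vertex, so lifting the
      edges alone gives a cycle.\<close>
    case False
    let ?es = "map g es'"
    have in_es: "x \<in> g h" if "h \<in> ?E'" "x \<in> h" "x \<in> set vs" for x h
      by (rule mem_contract_image(1)[of x e w "g h"]) (use g[OF that(1)] that False in auto)
    have es': "es' ! i \<in> ?E'" if "i < length es'" for i
      using hypercycleD(4)[OF C] that by (meson nth_mem subsetD)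
    have "hypercycle V E vs ?es"
      unfolding hypercycle_def
    proof (intro conjI allI impI)
      show "length vs = length ?es" "2 \<le> length ?es" "distinct vs"
        using hypercycleD[OF C] by simp_all
      show "set vs \<subseteq> V"
        using hypercycleD(3)[OF C] False mem_contract_image(1)[of _ e w V] by (metis subsetD subsetI)
      show "set ?es \<subseteq> E" using gE[OF hypercycleD(4)[OF C]] by blast
      show "distinct ?es" using hypercycleD(6)[OF C] g_inj[OF hypercycleD(4)[OF C]] by (simp add: distinct_map)
      fix i assume i: "i < length ?es"
      have "Suc i mod length es' < length es'" using i by (cases es') auto
      then have "vs ! i \<in> set vs" "vs ! (Suc i mod length es') \<in> set vs"
        using hypercycleD(1)[OF C] i by simp_all
      moreover have "{vs ! i, vs ! (Suc i mod length es')} \<subseteq> es' ! i"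
        using hypercycleD(7,8)[OF C] i by simp
      ultimately show "{vs ! i, vs ! (Suc i mod length ?es)} \<subseteq> ?es ! i"
        using in_es[OF es'] i by auto
    qed
    moreover have "?c ` \<Union>(set ?es) = \<Union>(set es')"
      by (rule gU[OF hypercycleD(4)[OF C]])
    ultimately show ?thesis by blast
  next
    case True
    then obtain k where k: "k < length vs" "vs ! k = w" by (auto simp: in_set_conv_nth)
    define rs where "rs = rotate k vs"
    define fs' where "fs' = rotate k es'"
    define fs where "fs = map g fs'"
    define n where "n = length fs"
    have R: "hypercycle (?c ` V) ?E' rs fs'"
      unfolding rs_def fs'_def by (rule hypercycle_rotate[OF C])
    have len: "length rs = n" "length fs' = n" "length fs = n" "n \<ge> 2"
      using hypercycleD(1,2)[OF R] by (auto simp: n_def fs_def)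
    have rs0: "rs ! 0 = w" using k nth_rotate[of 0 vs k] by (cases vs) (auto simp: rs_def)
    have fs'E: "fs' ! i \<in> ?E'" if "i < n" for i
      by (rule subsetD[OF hypercycleD(4)[OF R] nth_mem]) (use that len in simp)
    have rsw: "rs ! i \<noteq> w" if "0 < i" "i < n" for i
      using nth_eq_iff_index_eq[OF hypercycleD(5)[OF R], of i 0] that len rs0 by simp
    have fs_nth: "?c ` (fs ! i) = fs' ! i" if "i < n" for i
      using g[OF fs'E[OF that]] that len by (simp add: fs_def)
    have rs_in: "rs ! j \<in> fs ! i" if "i < n" "0 < j" "j < n" "rs ! j \<in> fs' ! i" for i j
      by (rule mem_contract_image(1)[of "rs ! j" e w "fs ! i"]) (use that rsw fs_nth in auto)
    have rs_fs': "rs ! i \<in> fs' ! i" "rs ! (Suc i mod n) \<in> fs' ! i" if "i < n" for i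
      using hypercycleD(7,8)[OF R] that len by simp_all
    have meets_e: "\<exists>a. a \<in> fs ! i \<and> a \<in> e" if "i < n" "w \<in> fs' ! i" for i
      using that e(2) unfolding fs_nth[OF that(1), symmetric] by (auto simp: contract_def split: if_splits)
    \<comment> \<open>The edges of the rotated cycle at \<open>w\<close> are the first and the last
      one; \<open>a\<close> and \<open>b\<close> are points where their lifts meet
      \<open>e\<close>.\<close>
    obtain a where a: "a \<in> fs ! 0" "a \<in> e"
      using meets_e[of 0] rs_fs'(1)[of 0] rs0 len by auto
    obtain b where b: "b \<in> fs ! (n - 1)" "b \<in> e"
      using meets_e[of "n - 1"] rs_fs'(2)[of "n - 1"] rs0 len by auto
    have fsE: "set fs \<subseteq> E - {e}"
      unfolding fs_def by (rule gE[OF hypercycleD(4)[OF R]])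
    have dfs: "distinct fs"
      using hypercycleD(6)[OF R] g_inj[OF hypercycleD(4)[OF R]] by (simp add: distinct_map fs_def)
    have Ufs: "?c ` \<Union>(set fs) = \<Union>(set es')"
      using gU[OF hypercycleD(4)[OF R]] by (simp add: fs_def fs'_def)
    have wU: "w \<in> \<Union>(set es')"
    proof -
      have "w \<in> fs' ! 0" using rs_fs'(1)[of 0] rs0 len by simp
      moreover have "fs' ! 0 \<in> set fs'" using len by (intro nth_mem) simp
      ultimately show ?thesis by (auto simp: fs'_def)
    qed
    \<comment> \<open>Only the entry \<open>w\<close> is replaced, by \<open>a\<close>; all other
      entries lie outside \<open>e\<close>, so the list remains distinct.\<close>
    define us where "us = rs[0 := a]"
    have us_len: "length us = n" by (simp add: us_def len)
    have us0: "us ! 0 = a" and us_nth: "\<And>i. 0 < i \<Longrightarrow> us ! i = rs ! i"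
      using len by (auto simp: us_def)
    have us_out: "us ! i \<in> V" "us ! i \<notin> e" if "0 < i" "i < n" for i
    proof -
      have "rs ! i \<in> ?c ` V" by (rule subsetD[OF hypercycleD(3)[OF R] nth_mem]) (use that len in simp)
      then show "us ! i \<in> V" "us ! i \<notin> e"
        using mem_contract_image[of "rs ! i" e w V] rsw that us_nth by auto
    qed
    have usV: "set us \<subseteq> V"
    proof
      fix x assume "x \<in> set us"
      then obtain i where i: "i < n" "x = us ! i" by (auto simp: in_set_conv_nth us_len)
      then show "x \<in> V" using us_out(1)[of i] us0 a e by (cases "i = 0") auto
    qed
    have dus: "distinct us"
    proof (unfold distinct_conv_nth us_len, intro allI impI)
      fix i j assume ij: "i < n" "j < n" "i \<noteq> j"
      show "us ! i \<noteq> us ! j"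
      proof (cases "i = 0 \<or> j = 0")
        case True
        then show ?thesis using us_out(2)[of i] us_out(2)[of j] us0 a ij by auto
      next
        case False
        then show ?thesis using hypercycleD(5)[OF R] ij len us_nth by (simp add: nth_eq_iff_index_eq)
      qed
    qed
    have us_fs1: "us ! i \<in> fs ! i" if "i < n" for i
      using rs_in[of i i] rs_fs'(1)[of i] us0 us_nth[of i] a that by (cases "i = 0") auto
    have us_fs2: "us ! Suc i \<in> fs ! i" if "Suc i < n" for i
      using rs_in[of i "Suc i"] rs_fs'(2)[of i] us_nth[of "Suc i"] that by auto
    show ?thesis
    proof (cases "a = b")
      case True
      have "hypercycle V E us fs"
        unfolding hypercycle_def
      proof (intro conjI allI impI)
        fix i assume "i < length fs"
        then have i: "i < n" by (simp add: len)
        show "{us ! i, us ! (Suc i mod length fs)} \<subseteq> fs ! i"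
        proof (cases "Suc i = n")
          case True
          then have "fs ! (n - 1) = fs ! i" by auto
          then show ?thesis using True us_fs1[OF i] us0 b \<open>a = b\<close> by (simp add: len)
        next
          case False
          then show ?thesis using us_fs1[OF i] us_fs2[of i] i by (simp add: len)
        qed
      qed (use us_len len usV fsE dus dfs in auto)
      then show ?thesis using Ufs by blast
    next
      case False
      have "hypercycle V E (us @ [b]) (fs @ [e])"
        unfolding hypercycle_def
      proof (intro conjI allI impI)
        have "b \<notin> set us"
        proof
          assume "b \<in> set us"
          then obtain i where i: "i < n" "b = us ! i" by (auto simp: in_set_conv_nth us_len)
          then show False using us_out(2)[of i] us0 b False by (cases "i = 0") auto
        qed
        then show "distinct (us @ [b])" using dus by simp
        show "distinct (fs @ [e])" using dfs fsE by auto
        fix i assume "i < length (fs @ [e])"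
        \<comment> \<open>Inner lifted edges, the last lifted edge, which now ends in
          \<open>b\<close>, and the added edge \<open>e\<close>, whose second end wraps around to
          \<open>a\<close>.\<close>
        then consider "Suc i < n" | "Suc i = n" | "i = n" using len(3) by fastforce
        then show "{(us @ [b]) ! i, (us @ [b]) ! (Suc i mod length (fs @ [e]))} \<subseteq> (fs @ [e]) ! i"
        proof cases
          case 1
          then show ?thesis using us_fs1[of i] us_fs2[of i] by (simp add: nth_append len us_len)
        next
          case 2
          then have "fs ! (n - 1) = fs ! i" by auto
          then show ?thesis using 2 us_fs1[of i] b by (simp add: nth_append len us_len)
        next
          case 3
          then show ?thesis using len(4) us0 a b by (simp add: nth_append len us_len)
        qed
      qed (use us_len len usV fsE e b in auto)
      moreover have "?c ` \<Union>(set (fs @ [e])) = \<Union>(set es')"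
      proof -
        \<comment> \<open>The added edge contributes only \<open>w\<close>, which the contracted
          cycle covers already.\<close>
        have "?c ` e = {w}" using e by (auto simp: contract_def)
        then show ?thesis using Ufs wU by (auto simp: image_Un)
      qed
      ultimately show ?thesis by blast
    qed
  qed
qed

lemma weak_L0'_contract:
  assumes L: "weak_L0' V E" and e: "e \<in> E" "w \<in> e" and indep: "\<not> contains_edge2 E e"
  shows "weak_L0' (contract e w ` V) ((`) (contract e w) ` (E - {e}))"
  unfolding weak_L0'_def
proof (intro conjI allI impI ballI)
  let ?c = "contract e w" and ?E' = "(`) (contract e w) ` (E - {e})"
  have H: "hypergraph V E" and conn: "cut_connected V E" using L by (auto simp: weak_L0'_def)
  have EV: "\<And>f. f \<in> E \<Longrightarrow> f \<subseteq> V" using H by (auto simp: hypergraph_def)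
  show "hypergraph (?c ` V) ?E'" by (rule hypergraph_contract[OF H])
  show "cut_connected (?c ` V) ?E'" by (rule cut_connected_contract[OF conn])
  show "contains_edge2 ?E' (\<Union> (set es'))" if "hypercycle (?c ` V) ?E' vs es'" for vs es'
  proof -
    obtain us es where "hypercycle V E us es" "?c ` \<Union>(set es) = \<Union>(set es')"
      using hypercycle_lift_contract[OF e EV[OF e(1)] \<open>hypercycle (?c ` V) ?E' vs es'\<close>] by blast
    then show ?thesis
      using L contains_edge2_contract[OF _ e(2) indep] unfolding weak_L0'_def by metis
  qed
  fix f' assume "f' \<in> ?E'"
  then obtain f where f: "f \<in> E" "f \<noteq> e" "f' = ?c ` f" by blast
  show "even (card f') \<or> contains_edge2 ?E' f'"
  proof (cases "contains_edge2 E f")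
    case True
    then show ?thesis using contains_edge2_contract[OF _ e(2) indep] f by simp
  next
    case False
    show ?thesis
    proof (cases "\<exists>x\<in>f \<inter> e. \<exists>y\<in>f \<inter> e. x \<noteq> y")
      case True
      then obtain x y where xy: "x \<in> f \<inter> e" "y \<in> f \<inter> e" "x \<noteq> y" by blast
      \<comment> \<open>Two common vertices give a cycle of length 2. Its union contains an edge of
        size 2 and contracts to \<open>f'\<close>, because \<open>f\<close> meets
        \<open>e\<close>.\<close>
      have "hypercycle V E [x, y] [e, f]"
        using xy f e EV by (auto simp: hypercycle_def nth_Cons less_Suc_eq split: nat.splits)
      then have "contains_edge2 E (\<Union> (set [e, f]))" using L unfolding weak_L0'_def by blast
      then have "contains_edge2 ?E' (?c ` (e \<union> f))"
        using contains_edge2_contract[OF _ e(2) indep] by simp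
      moreover have "?c ` (e \<union> f) = f'" using xy f by (auto simp: contract_def)
      ultimately show ?thesis by simp
    next
      case noteq: False
      \<comment> \<open>With at most one vertex of \<open>f\<close> in \<open>e\<close>, the
        contraction preserves the size of \<open>f\<close>, hence its parity.\<close>
      have "inj_on ?c f"
        using noteq e(2) by (auto simp: inj_on_def contract_def)
      moreover have "even (card f)" using L False f unfolding weak_L0'_def by blast
      ultimately show ?thesis by (simp add: f card_image)
    qed
  qed
qed

lemma class_L0'_imp_weak_L0':
  assumes "hypergraph V E" "class_L0' V E"
  shows "weak_L0' V E"
  using assms connected2_imp_cut_connected[of V E]
  unfolding weak_L0'_def class_L0'_def contains_edge2_def by simp

subsection \<open>Sign of the chromatic quotient\<close>

text \<open>Two distinct edges of size 2 share at most one vertex, so contracting one is injective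
  on the other; thus graphs contract to graphs.\<close>

lemma card_contract_edge2:
  assumes "card e = 2" "card f = 2" "f \<noteq> e" "w \<in> e"
  shows "card (contract e w ` f) = 2"
proof -
  have "inj_on (contract e w) f"
  proof (rule inj_onI)
    fix x y assume xy: "x \<in> f" "y \<in> f" "contract e w x = contract e w y"
    show "x = y"
    proof (rule ccontr)
      assume "x \<noteq> y"
      then have "x \<in> e" "y \<in> e" using xy(3) assms(4) by (auto simp: contract_def split: if_splits)
      then have "{x, y} \<subseteq> e" "{x, y} \<subseteq> f" "card {x, y} = 2" using xy \<open>x \<noteq> y\<close> by auto
      then have "{x, y} = e" "{x, y} = f"
        using assms by (metis card_subset_eq card.infinite zero_neq_numeral)+
      then show False using assms by simp
    qed
  qed
  then show ?thesis using assms by (simp add: card_image)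
qed

lemma weak_L0'_alternating:
  assumes "weak_L0' V E"
  shows "alternating V E"
  using assms
proof (induction "card E" arbitrary: V E rule: less_induct)
  case less
  have H: "hypergraph V E" and conn: "cut_connected V E" using less.prems by (auto simp: weak_L0'_def)
  have finV: "finite V" and EV: "\<And>f. f \<in> E \<Longrightarrow> f \<subseteq> V" using H by (auto simp: hypergraph_def)
  have finE: "finite E" by (rule hypergraph_finite_edges[OF H])
  have del_less: "card (E - {e}) < card E" if "e \<in> E" for e
    using finE that by (rule card_Diff1_less)
  have con_less: "card ((`) (contract e w) ` (E - {e})) < card E" if "e \<in> E" for e w
    using card_image_le[of "E - {e}" "(`) (contract e w)"] del_less[OF that] finE by simp
  consider e where "e \<in> E" "card e \<noteq> 2" "contains_edge2 E e"
    | e where "e \<in> E" "card e \<noteq> 2" "\<not> contains_edge2 E e"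
    | "\<forall>e\<in>E. card e = 2" by blast
  then show ?case
  proof cases
    case 1
    have "alternating V (E - {e})"
      using less.hyps[OF del_less] weak_L0'_delete[OF less.prems] 1 by blast
    then show ?thesis
      using chromatic_quotient_delete_redundant[OF H 1] by (simp add: alternating_def)
  next
    case 2
    obtain w where w: "w \<in> e" using H 2 by (auto simp: hypergraph_def)
    show ?thesis
    proof (rule alternating_delete_contract[OF H 2(1) w])
      \<comment> \<open>The invariant allows odd size only for edges that contain an edge of size
        2.\<close>
      show "even (card e)" using less.prems 2 unfolding weak_L0'_def by blast
      show "alternating V (E - {e})"
        using less.hyps[OF del_less] weak_L0'_delete[OF less.prems] 2 by blast
      show "alternating (contract e w ` V) ((`) (contract e w) ` (E - {e}))"
        using less.hyps[OF con_less] weak_L0'_contract[OF less.prems 2(1) w 2(3)] 2 by blast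
    qed
  next
    case 3
    show ?thesis
    proof (cases "card V \<ge> 2")
      case False
      have "V \<noteq> {}" using conn by (simp add: cut_connected_def)
      then have "card V = 1" using False finV by (metis One_nat_def card_0_eq less_2_cases not_le)
      then obtain v where "V = {v}" by (rule card_1_singletonE)
      moreover have "E = {}"
        using 3 EV False card_mono[OF finV] by (metis equals0I)
      ultimately show ?thesis by (simp add: alternating_single_vertex)
    next
      case True
      obtain v where v: "v \<in> V" and conn': "cut_connected (V - {v}) E"
        using exists_non_cut_vertex[OF conn finV True] by blast
      \<comment> \<open>The cut around \<open>v\<close> yields a neighbor \<open>u\<close>.\<close>
      have "{v} \<subset> V" using v True by auto
      then obtain u where u: "u \<in> V - {v}" "{v, u} \<in> E"
        using conn unfolding cut_connected_def by blast
      let ?e = "{u, v}"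
      have e: "?e \<in> E" using u by (simp add: insert_commute)
      \<comment> \<open>The deleted edge ends at \<open>v\<close>, so it crosses no cut of
        \<open>V - {v}\<close>.\<close>
      have conn_e: "cut_connected (V - {v}) (E - {?e})"
        by (rule cut_connected_mono[OF conn']) (auto simp: doubleton_eq_iff)
      show ?thesis
      proof (cases "\<exists>u'\<in>V - {v}. u' \<noteq> u \<and> {u', v} \<in> E")
        case True
        then obtain u' where u': "u' \<in> V - {v}" "u' \<noteq> u" "{u', v} \<in> E" by blast
        show ?thesis
        proof (rule alternating_delete_contract[OF H e, of u])
          show "even (card ?e)" using u by auto
          \<comment> \<open>A second neighbor \<open>u'\<close> keeps \<open>v\<close> attached once
            \<open>{u, v}\<close> is deleted.\<close>
          have "{u', v} \<in> E - {?e}" using u' by (auto simp: doubleton_eq_iff)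
          then have "cut_connected (insert v (V - {v})) (E - {?e})"
            using cut_connected_insert[OF conn_e u'(1)] by blast
          then have "cut_connected V (E - {?e})" using v by (simp add: insert_absorb)
          then have "weak_L0' V (E - {?e})"
            using H 3 by (intro weak_L0'_graph) (auto simp: hypergraph_def)
          then show "alternating V (E - {?e})" using less.hyps[OF del_less[OF e]] by blast
          have "\<forall>f\<in>(`) (contract ?e u) ` (E - {?e}). card f = 2"
            using card_contract_edge2[of ?e _ u] 3 e by auto
          then have "weak_L0' (contract ?e u ` V) ((`) (contract ?e u) ` (E - {?e}))"
            using H conn by (intro weak_L0'_graph hypergraph_contract cut_connected_contract) auto
          then show "alternating (contract ?e u ` V) ((`) (contract ?e u) ` (E - {?e}))"
            using less.hyps[OF con_less[OF e]] by blast
        qed simp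
      next
        case False
        \<comment> \<open>Here \<open>u\<close> is the only neighbor of \<open>v\<close>, so the
          rest is a hypergraph on \<open>V - {v}\<close> to which \<open>v\<close> is attached as a
          leaf.\<close>
        have "v \<notin> f" if f: "f \<in> E - {?e}" for f
        proof
          assume "v \<in> f"
          moreover have "card f = 2" using f 3 by blast
          ultimately obtain y where "f = {y, v}" "y \<noteq> v" by (metis card_2_iff insert_commute insertE singletonD)
          then show False using False f EV[of f] by auto
        qed
        then have H': "hypergraph (V - {v}) (E - {?e})" using H by (auto simp: hypergraph_def)
        then have "weak_L0' (V - {v}) (E - {?e})"
          using 3 conn_e by (intro weak_L0'_graph) auto
        then have "alternating (V - {v}) (E - {?e})" using less.hyps[OF del_less[OF e]] by blast
        then have "alternating (insert v (V - {v})) (insert ?e (E - {?e}))"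
          using H' u by (intro alternating_leaf) auto
        then show ?thesis using v e by (simp add: insert_absorb)
      qed
    qed
  qed
qed

theorem theorem4p1:
  fixes V :: "'a set" and E :: "'a set set"
  assumes "hypergraph V E"
    and "class_L0' V E"
  shows "\<forall>x::real. 0 \<le> x \<and> x < 1 \<longrightarrow>
           (-1) ^ (card V + 1) * poly (chromatic_quotient V E) x > 0"
  using weak_L0'_alternating[OF class_L0'_imp_weak_L0'[OF assms]] unfolding alternating_def .

end
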